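(* The real doubly stochastic inverse eigenvalue problem and the symmetric doubly stochastic inverse eigenvalue problem are equivalent for $n=3$. That is, a list $(\lambda_1,\lambda_2,\lambda_3)$ of three real numbers is the spectrum of some $3\times 3$ doubly stochastic matrix if and only if it is the spectrum of some $3\times 3$ symmetric doubly stochastic matrix.
   Context: An $n\times n$ real matrix is doubly stochastic if all its entries are nonnegative and each row sum and each column sum equals $1$. A list of $n$ numbers is the spectrum of an $n\times n$ matrix if it is the list of its eigenvalues, counted with algebraic multiplicity. The real doubly stochastic inverse eigenvalue problem (RDIEP) asks which lists of $n$ real numbers occur as the spectrum of an $n\times n$ doubly stochastic matrix. The symmetric doubly stochastic inverse eigenvalue problem (SDIEP) asks which lists of $n$ real numbers occur as the spectrum of an $n\times n$ symmetric doubly stochastic matrix. *)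

theory Defs
  imports "Jordan_Normal_Form.Spectral_Radius"
begin

definition doubly_stochastic_mat :: "real mat \<Rightarrow> bool" where
  "doubly_stochastic_mat A \<longleftrightarrow> square_mat A \<and>
     (\<forall>i < dim_row A. \<forall>j < dim_col A. A $$ (i, j) \<ge> 0) \<and>
     (\<forall>i < dim_row A. (\<Sum>j < dim_col A. A $$ (i, j)) = 1) \<and>
     (\<forall>j < dim_col A. (\<Sum>i < dim_row A. A $$ (i, j)) = 1)"

definition symmetric_mat :: "'a mat \<Rightarrow> bool" where
  "symmetric_mat A \<longleftrightarrow> transpose_mat A = A"

definition algebraic_multiplicity :: "'a :: field mat \<Rightarrow> 'a \<Rightarrow> nat" where
  "algebraic_multiplicity A k = order k (char_poly A)"

(* The order of the entries of the list is irrelevant. *)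
definition is_spectrum_list :: "complex mat \<Rightarrow> complex list \<Rightarrow> bool" where
  "is_spectrum_list A ks \<longleftrightarrow> square_mat A \<and> length ks = dim_row A \<and>
     set ks = spectrum A \<and>
     (\<forall>k \<in> spectrum A. count_list ks k = algebraic_multiplicity A k)"

(* Eigenvalues of real matrices are taken over the complex numbers, so a real list
   is the spectrum only of matrices without non-real eigenvalues. *)
definition has_real_spectrum :: "real mat \<Rightarrow> real list \<Rightarrow> bool" where
  "has_real_spectrum A ls \<longleftrightarrow>
     is_spectrum_list (map_mat complex_of_real A) (map complex_of_real ls)"

definition rdiep_realizable :: "nat \<Rightarrow> real list \<Rightarrow> bool" where
  "rdiep_realizable n ls \<longleftrightarrow>
     (\<exists>A \<in> carrier_mat n n. doubly_stochastic_mat A \<and> has_real_spectrum A ls)"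

definition sdiep_realizable :: "nat \<Rightarrow> real list \<Rightarrow> bool" where
  "sdiep_realizable n ls \<longleftrightarrow>
     (\<exists>A \<in> carrier_mat n n. symmetric_mat A \<and> doubly_stochastic_mat A \<and> has_real_spectrum A ls)"

end

theory Submission
  imports Defs
begin

text \<open>
  The row sums force \<open>1\<close> into the spectrum of a doubly stochastic matrix, so up to order the list
  is \<open>1, a, b\<close>. If it is the spectrum of a doubly stochastic matrix of order three, then
  \<open>a \<le> 1\<close>, \<open>b \<le> 1\<close>, \<open>2 + 3 a + b \<ge> 0\<close> and \<open>2 + a + 3 b \<ge> 0\<close>
  (\<open>doubly_stochastic_3_spectrum_bounds\<close>). Indeed, the sum and the product of \<open>a\<close> and \<open>b\<close> are
  polynomials in the entries of the matrix, and so are \<open>(1 - a) (1 - b)\<close> and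
  \<open>(2 + 3 a + b) (2 + a + 3 b)\<close>. Writing \<open>p, s, e\<close> for the diagonal and \<open>q, r\<close> for the entries in
  positions \<open>(0,1)\<close> and \<open>(1,0)\<close>, the first product equals \<open>3 ((1 - p) (1 - s) - q r)\<close>, where
  \<open>q \<le> 1 - p\<close> and \<open>r \<le> 1 - s\<close>, and the second equals
  \<open>12 (p s + p e + s e) + 3 (q - r)\<^sup>2\<close>. Hence both products are nonnegative. In each of them the two
  factors have a nonnegative sum, so each factor is nonnegative.

  Conversely, these bounds are enough for a symmetric realization
  (\<open>sdiep_realizable_3\<close>): arrange that \<open>b \<le> a\<close> and take the symmetric matrix that has the
  eigenvalues \<open>1, a, b\<close> on the orthogonal eigenvectors \<open>(1,1,1)\<close>, \<open>(1,1,-2)\<close>, \<open>(1,-1,0)\<close>.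

  Comparing characteristic polynomials is legitimate because a list is the spectrum
  of a matrix exactly if the characteristic polynomial is the product of the corresponding linear
  factors (\<open>has_real_spectrum_iff_char_poly\<close>).
\<close>

section \<open>Spectrum lists and the characteristic polynomial\<close>

lemma order_prod_linear_factors:
  fixes k :: "'a :: field"
  shows "order k (\<Prod>a\<leftarrow>as. [:- a, 1:]) = count_list as k"
proof (induction as)
  case Nil
  then show ?case by simp
next
  case (Cons a as)
  have nz: "(\<Prod>a\<leftarrow>as. [:- a, 1:]) \<noteq> 0"
    by (auto simp: prod_list_zero_iff)
  have "order k [:- a, 1:] = (if a = k then 1 else 0)"
    using order_power_n_n[of a 1] by (auto intro: order_0I)
  moreover have "order k ([:- a, 1:] * (\<Prod>a\<leftarrow>as. [:- a, 1:]))
      = order k [:- a, 1:] + order k (\<Prod>a\<leftarrow>as. [:- a, 1:])"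
    using nz by (intro order_mult) (simp del: mult_pCons_left)
  ultimately show ?case
    using Cons.IH by (simp del: mult_pCons_left)
qed

text \<open>
  Over the complex numbers the characteristic polynomial splits, and its list of roots is determined
  up to order by the multiplicities; the length condition in the definition is then automatic.
\<close>

lemma is_spectrum_list_iff_char_poly:
  assumes A: "A \<in> carrier_mat n n"
  shows "is_spectrum_list A ks \<longleftrightarrow> char_poly A = (\<Prod>k\<leftarrow>ks. [:- k, 1:])"
proof
  assume *: "is_spectrum_list A ks"
  obtain as where as: "char_poly A = (\<Prod>a\<leftarrow>as. [:- a, 1:])"
    using char_poly_factorized[OF A] by blast
  have set_as: "spectrum A = set as"
    by (auto simp: spectrum_def eigenvalue_root_char_poly[OF A] as poly_prod_list prod_list_zero_iff)
  have "count_list ks k = count_list as k" for k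
  proof (cases "k \<in> spectrum A")
    case True
    with * show ?thesis
      by (simp add: is_spectrum_list_def algebraic_multiplicity_def as order_prod_linear_factors)
  next
    case False
    with * set_as show ?thesis
      by (simp add: is_spectrum_list_def count_list_0_iff)
  qed
  then have "mset ks = mset as"
    by (intro multiset_eqI) (simp add: count_mset)
  then have "mset (map (\<lambda>k. [:- k, 1:]) ks) = mset (map (\<lambda>k. [:- k, 1:]) as)"
    by simp
  then show "char_poly A = (\<Prod>k\<leftarrow>ks. [:- k, 1:])"
    unfolding as by (metis prod_mset_prod_list)
next
  assume *: "char_poly A = (\<Prod>k\<leftarrow>ks. [:- k, 1:])"
  have "length ks = n"
    using degree_linear_factors[of uminus ks] degree_monic_char_poly[OF A] * by simp
  moreover have "spectrum A = set ks"
    by (auto simp: spectrum_def eigenvalue_root_char_poly[OF A] * poly_prod_list prod_list_zero_iff)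
  ultimately show "is_spectrum_list A ks"
    using A by (auto simp: is_spectrum_list_def algebraic_multiplicity_def * order_prod_linear_factors)
qed

lemma has_real_spectrum_iff_char_poly:
  assumes A: "A \<in> carrier_mat n n"
  shows "has_real_spectrum A ls \<longleftrightarrow> char_poly A = (\<Prod>l\<leftarrow>ls. [:- l, 1:])"
proof -
  interpret h: map_poly_inj_idom_hom complex_of_real ..
  have "has_real_spectrum A ls \<longleftrightarrow>
      map_poly complex_of_real (char_poly A) = (\<Prod>k\<leftarrow>map complex_of_real ls. [:- k, 1:])"
    using A by (simp add: has_real_spectrum_def is_spectrum_list_iff_char_poly[of _ n]
        of_real_hom.char_poly_hom[OF A])
  also have "(\<Prod>k\<leftarrow>map complex_of_real ls. [:- k, 1:])
      = map_poly complex_of_real (\<Prod>l\<leftarrow>ls. [:- l, 1:])"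
    by (simp add: h.hom_prod_list o_def of_real_hom.map_poly_pCons_hom)
  finally show ?thesis
    by (simp only: h.eq_iff)
qed

lemma has_real_spectrum_cong_mset:
  assumes A: "A \<in> carrier_mat n n" and "mset ks = mset ls"
  shows "has_real_spectrum A ks \<longleftrightarrow> has_real_spectrum A ls"
proof -
  have "mset (map (\<lambda>k. [:- k, 1:]) ks) = mset (map (\<lambda>k. [:- k, 1:]) ls)"
    using assms by simp
  then have "(\<Prod>k\<leftarrow>ks. [:- k, 1:]) = (\<Prod>k\<leftarrow>ls. [:- k, 1:])"
    by (metis prod_mset_prod_list)
  then show ?thesis
    by (simp add: has_real_spectrum_iff_char_poly[OF A])
qed

section \<open>Matrices of order three\<close>

lemma sum_lessThan_3: "(\<Sum>i<3. f i) = f 0 + f 1 + f (2 :: nat)"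
  by (simp add: numeral_3_eq_3 numeral_2_eq_2)

lemma all_less_3: "(\<forall>i<3. P i) \<longleftrightarrow> P 0 \<and> P 1 \<and> P (2 :: nat)"
  by (auto simp: numeral_3_eq_3 numeral_2_eq_2 less_Suc_eq)

lemma det_mat_2:
  fixes A :: "'a :: comm_ring_1 mat"
  assumes A: "A \<in> carrier_mat 2 2"
  shows "det A = A $$ (0,0) * A $$ (1,1) - A $$ (0,1) * A $$ (1,0)"
  using A
  by (subst laplace_expansion_row[OF A, of 0])
    (auto simp: cofactor_def mat_delete_def numeral_2_eq_2 det_single algebra_simps)

lemma det_mat_3:
  fixes A :: "'a :: comm_ring_1 mat"
  assumes A: "A \<in> carrier_mat 3 3"
  shows "det A =
      A $$ (0,0) * (A $$ (1,1) * A $$ (2,2) - A $$ (1,2) * A $$ (2,1))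
    - A $$ (0,1) * (A $$ (1,0) * A $$ (2,2) - A $$ (1,2) * A $$ (2,0))
    + A $$ (0,2) * (A $$ (1,0) * A $$ (2,1) - A $$ (1,1) * A $$ (2,0))"
proof -
  have d: "det (mat_delete A 0 j) = mat_delete A 0 j $$ (0,0) * mat_delete A 0 j $$ (1,1)
      - mat_delete A 0 j $$ (0,1) * mat_delete A 0 j $$ (1,0)" for j
    using A by (intro det_mat_2) (auto simp: mat_delete_def)
  show ?thesis
    using A
    by (subst laplace_expansion_row[OF A, of 0])
      (auto simp: sum_lessThan_3 cofactor_def d, auto simp: mat_delete_def numeral_2_eq_2 algebra_simps)
qed

lemma poly_char_poly_3:
  fixes A :: "'a :: field mat"
  assumes A: "A \<in> carrier_mat 3 3"
  shows "poly (char_poly A) x =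
      (x - A $$ (0,0)) * ((x - A $$ (1,1)) * (x - A $$ (2,2)) - A $$ (1,2) * A $$ (2,1))
    - A $$ (0,1) * (A $$ (1,0) * (x - A $$ (2,2)) + A $$ (1,2) * A $$ (2,0))
    - A $$ (0,2) * (A $$ (1,0) * A $$ (2,1) + (x - A $$ (1,1)) * A $$ (2,0))"
proof -
  have "char_poly_matrix A \<in> carrier_mat 3 3"
    using A by simp
  then show ?thesis
    using A by (simp add: char_poly_def det_mat_3 char_poly_matrix_def algebra_simps)
qed

lemma has_real_spectrum_3_iff:
  assumes A: "A \<in> carrier_mat 3 3"
  shows "has_real_spectrum A [l1, l2, l3] \<longleftrightarrow>
    (\<forall>x. poly (char_poly A) x = (x - l1) * (x - l2) * (x - l3))"
proof -
  have "has_real_spectrum A [l1, l2, l3] \<longleftrightarrow>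
      poly (char_poly A) = poly (\<Prod>l\<leftarrow>[l1, l2, l3]. [:- l, 1:])"
    unfolding has_real_spectrum_iff_char_poly[OF A] by (simp only: poly_eq_poly_eq_iff)
  also have "\<dots> \<longleftrightarrow> (\<forall>x. poly (char_poly A) x = (x - l1) * (x - l2) * (x - l3))"
    by (simp add: fun_eq_iff poly_prod_list algebra_simps)
  finally show ?thesis .
qed

lemma doubly_stochastic_mat_3_iff:
  assumes A: "A \<in> carrier_mat 3 3"
  shows "doubly_stochastic_mat A \<longleftrightarrow>
    (\<forall>i<3. \<forall>j<3. A $$ (i,j) \<ge> 0) \<and>
    (\<forall>i<3. A $$ (i,0) + A $$ (i,1) + A $$ (i,2) = 1) \<and>
    (\<forall>j<3. A $$ (0,j) + A $$ (1,j) + A $$ (2,j) = 1)"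
  using A by (auto simp: doubly_stochastic_mat_def sum_lessThan_3)

section \<open>The spectra of doubly stochastic matrices of order three\<close>

text \<open>
  The row and column sums express every entry through the four in the upper left corner. The
  factor \<open>x - 1\<close> splits off, and the constant term of the quadratic factor is the determinant.
\<close>

lemma doubly_stochastic_3_poly_char_poly:
  assumes A: "A \<in> carrier_mat 3 3" and ds: "doubly_stochastic_mat A"
  defines "p \<equiv> A $$ (0,0)" and "q \<equiv> A $$ (0,1)" and "r \<equiv> A $$ (1,0)" and "s \<equiv> A $$ (1,1)"
  defines "e \<equiv> A $$ (2,2)"
  shows "poly (char_poly A) x =
    (x - 1) * (x\<^sup>2 - (p + s + e - 1) * x + (3 * (p * s - q * r) - p - s + q + r))"
proof -
  have entries: "A $$ (0,2) = 1 - p - q" "A $$ (1,2) = 1 - r - s"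
    "A $$ (2,0) = 1 - p - r" "A $$ (2,1) = 1 - q - s" and e: "e = p + q + r + s - 1"
    using ds unfolding doubly_stochastic_mat_3_iff[OF A] all_less_3 p_def q_def r_def s_def e_def
    by linarith+
  show ?thesis
    unfolding poly_char_poly_3[OF A] entries p_def[symmetric] q_def[symmetric] r_def[symmetric]
      s_def[symmetric] e_def[symmetric] e
    by (simp add: algebra_simps power2_eq_square)
qed

text \<open>
  The necessary conditions are symmetric in \<open>a\<close> and \<open>b\<close>, so no order between them is needed here.
\<close>

lemma doubly_stochastic_3_spectrum_bounds:
  assumes A: "A \<in> carrier_mat 3 3" and ds: "doubly_stochastic_mat A"
    and sp: "has_real_spectrum A [1, a, b]"
  shows "a \<le> 1" "b \<le> 1" "2 + 3 * a + b \<ge> 0" "2 + a + 3 * b \<ge> 0"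
proof -
  define p q r s e where defs: "p = A $$ (0,0)" "q = A $$ (0,1)" "r = A $$ (1,0)"
    "s = A $$ (1,1)" "e = A $$ (2,2)"
  have nonneg: "p \<ge> 0" "q \<ge> 0" "r \<ge> 0" "s \<ge> 0" "e \<ge> 0"
    and rows: "p + q \<le> 1" "r + s \<le> 1" and e: "e = p + q + r + s - 1"
    using ds unfolding doubly_stochastic_mat_3_iff[OF A] all_less_3 defs by linarith+
  have *: "(x - 1) * (x\<^sup>2 - (p + s + e - 1) * x + (3 * (p * s - q * r) - p - s + q + r))
      = (x - 1) * (x - a) * (x - b)" for x
    using sp unfolding has_real_spectrum_3_iff[OF A] doubly_stochastic_3_poly_char_poly[OF A ds] defs
    by blast
  have ab: "a * b = 3 * (p * s - q * r) - p - s + q + r"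
    using *[of 0] by simp
  have sum_ab: "a + b = p + s + e - 1"
    using *[of "-1"] ab by (simp add: algebra_simps)

  \<comment> \<open>\<open>I - A\<close> has the eigenvalues \<open>0, 1 - a, 1 - b\<close>, so \<open>(1 - a) (1 - b)\<close> is the sum of its
    principal minors of order two. These are all equal, since its rows and columns sum to zero.\<close>
  have "(1 - a) * (1 - b) = 3 * ((1 - p) * (1 - s) - q * r)"
    using ab sum_ab e by (simp add: algebra_simps)
  moreover have "q * r \<le> (1 - p) * (1 - s)"
    using nonneg rows by (intro mult_mono) auto
  ultimately have "(1 - a) * (1 - b) \<ge> 0" by simp
  moreover have "(1 - a) + (1 - b) \<ge> 0"
    using sum_ab e rows nonneg ds unfolding doubly_stochastic_mat_3_iff[OF A] all_less_3 defs
    by linarith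
  ultimately show "a \<le> 1" "b \<le> 1"
    by (auto simp: zero_le_mult_iff)

  have "(2 + 3 * a + b) * (2 + a + 3 * b)
      = 4 + 8 * (a + b) + 3 * (a + b)\<^sup>2 + 4 * (a * b)"
    by (simp add: algebra_simps power2_eq_square)
  also have "\<dots> = 12 * (p * s + p * e + s * e) + 3 * (q - r)\<^sup>2"
    unfolding ab sum_ab e by (simp add: algebra_simps power2_eq_square)
  finally have "(2 + 3 * a + b) * (2 + a + 3 * b) \<ge> 0"
    using nonneg by simp
  moreover have "(2 + 3 * a + b) + (2 + a + 3 * b) \<ge> 0"
    using sum_ab nonneg by simp
  ultimately show "2 + 3 * a + b \<ge> 0" "2 + a + 3 * b \<ge> 0"
    by (auto simp: zero_le_mult_iff)
qed

text \<open>
  The matrix is \<open>u u\<^sup>T / 3 + a v v\<^sup>T / 6 + b w w\<^sup>T / 2\<close> with \<open>u = (1,1,1)\<close>, \<open>v = (1,1,-2)\<close> and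
  \<open>w = (1,-1,0)\<close>. Only the entries \<open>1/3 + a/6 + b/2\<close> need the bound on \<open>2 + a + 3 b\<close>
  itself; the bottom right entry is nonnegative because \<open>b \<le> a\<close> then gives \<open>a \<ge> - 1/2\<close>.
\<close>

lemma sdiep_realizable_3:
  fixes a b :: real
  assumes ba: "b \<le> a" and a: "a \<le> 1" and b: "2 + a + 3 * b \<ge> 0"
  shows "sdiep_realizable 3 [1, a, b]"
proof -
  define A :: "real mat" where
    "A = mat 3 3 (\<lambda>(i, j).
      if i = 2 \<and> j = 2 then 1/3 + 2*a/3
      else if i = 2 \<or> j = 2 then 1/3 - a/3
      else if i = j then 1/3 + a/6 + b/2
      else 1/3 + a/6 - b/2)"
  have A: "A \<in> carrier_mat 3 3"
    by (simp add: A_def)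
  have entries:
    "A $$ (0,0) = 1/3 + a/6 + b/2" "A $$ (0,1) = 1/3 + a/6 - b/2" "A $$ (0,2) = 1/3 - a/3"
    "A $$ (1,0) = 1/3 + a/6 - b/2" "A $$ (1,1) = 1/3 + a/6 + b/2" "A $$ (1,2) = 1/3 - a/3"
    "A $$ (2,0) = 1/3 - a/3" "A $$ (2,1) = 1/3 - a/3" "A $$ (2,2) = 1/3 + 2*a/3"
    by (simp_all add: A_def)
  have "symmetric_mat A"
    unfolding symmetric_mat_def by (rule eq_matI) (simp_all add: A_def)
  moreover have ds: "doubly_stochastic_mat A"
    unfolding doubly_stochastic_mat_3_iff[OF A] all_less_3 entries
    using assms by (intro conjI) linarith+
  moreover have "has_real_spectrum A [1, a, b]"
  proof -
    \<comment> \<open>The coefficients of the quadratic factor: sum and product of the other two eigenvalues.\<close>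
    have tr: "(1/3 + a/6 + b/2) + (1/3 + a/6 + b/2) + (1/3 + 2*a/3) - 1 = a + b"
      by simp
    have "(1/3 + a/6 + b/2) * (1/3 + a/6 + b/2) - (1/3 + a/6 - b/2) * (1/3 + a/6 - b/2)
        = (2 + a) * b / 3"
      by (simp add: algebra_simps)
    then have dt: "3 * ((1/3 + a/6 + b/2) * (1/3 + a/6 + b/2) - (1/3 + a/6 - b/2) * (1/3 + a/6 - b/2))
        - (1/3 + a/6 + b/2) - (1/3 + a/6 + b/2) + (1/3 + a/6 - b/2) + (1/3 + a/6 - b/2) = a * b"
      by (simp only:) (simp add: algebra_simps)
    show ?thesis
      unfolding has_real_spectrum_3_iff[OF A] doubly_stochastic_3_poly_char_poly[OF A ds] entries tr dt
      by (simp add: algebra_simps power2_eq_square)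
  qed
  ultimately show ?thesis
    using A unfolding sdiep_realizable_def by blast
qed

lemma rdiep_realizable_3_imp_sdiep_realizable:
  assumes "rdiep_realizable 3 [l1, l2, l3]"
  shows "sdiep_realizable 3 [l1, l2, l3]"
proof -
  obtain A where A: "A \<in> carrier_mat 3 3" and ds: "doubly_stochastic_mat A"
    and sp: "has_real_spectrum A [l1, l2, l3]"
    using assms unfolding rdiep_realizable_def by blast
  have chi: "poly (char_poly A) x = (x - l1) * (x - l2) * (x - l3)" for x
    using sp unfolding has_real_spectrum_3_iff[OF A] by blast
  have "(1 - l1) * (1 - l2) * (1 - l3) = 0"
    using doubly_stochastic_3_poly_char_poly[OF A ds, of 1] chi[of 1] by simp
  then consider "l1 = 1" | "l2 = 1" | "l3 = 1"
    by auto
  then obtain a b where "mset [l1, l2, l3] = mset [1, a, b]"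
  proof cases
    case 1
    then show ?thesis using that[of l2 l3] by simp
  next
    case 2
    then show ?thesis using that[of l1 l3] by (simp add: add_mset_commute)
  next
    case 3
    then show ?thesis using that[of l1 l2] by (simp add: add_mset_commute)
  qed
  moreover from this have "mset [l1, l2, l3] = mset [1, b, a]"
    by (simp add: add_mset_commute)
  ultimately have "\<exists>a b. b \<le> a \<and> mset [l1, l2, l3] = mset [1, a, b]"
    using linear[of a b] by blast
  then obtain a b where ba: "b \<le> a" and ab: "mset [l1, l2, l3] = mset [1, a, b]"
    by blast
  have "has_real_spectrum A [1, a, b]"
    using sp has_real_spectrum_cong_mset[OF A ab] by simp
  then have "sdiep_realizable 3 [1, a, b]"
    using doubly_stochastic_3_spectrum_bounds[OF A ds] ba by (intro sdiep_realizable_3) auto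
  then show ?thesis
    using has_real_spectrum_cong_mset[OF _ ab] unfolding sdiep_realizable_def by blast
qed

theorem corollary3p3:
  fixes l1 l2 l3 :: real
  shows "rdiep_realizable 3 [l1, l2, l3] \<longleftrightarrow> sdiep_realizable 3 [l1, l2, l3]"
proof
  show "rdiep_realizable 3 [l1, l2, l3]" if "sdiep_realizable 3 [l1, l2, l3]"
    using that unfolding rdiep_realizable_def sdiep_realizable_def by blast
qed (rule rdiep_realizable_3_imp_sdiep_realizable)

end
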